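(* Let $n\ge 2$ and let $f,g\in\mathbb{C}[z_1,\ldots,z_n]$ be polynomials with $f(0)=g(0)=0$. For every sufficiently small $\varepsilon>0$, a point $p\in S_\varepsilon\setminus K_{fg}$ is a singular point of the Milnor fibration product map $\Phi:S_\varepsilon\setminus K_{fg}\to T^2$ associated with $f$ and $g$ if and only if the three vectors $p$, $i\,\mathrm{grad}\log f(p)$ and $i\,\mathrm{grad}\log g(p)$ are linearly dependent over $\mathbb{R}$.
   Context: $S_\varepsilon=\{z\in\mathbb{C}^n\mid \|z\|=\varepsilon\}$ and $K_{fg}=\{z\in S_\varepsilon\mid f(z)g(z)=0\}$. The Milnor fibration product map associated with $f,g$ is the $C^\infty$ map $\Phi:S_\varepsilon\setminus K_{fg}\to S^1\times S^1=T^2$, $\Phi(z)=\left(\frac{f(z)}{|f(z)|},\frac{g(z)}{|g(z)|}\right)$. A point $p$ is a singular point of $\Phi$ if $\mathrm{rank}\,d\Phi_p<2$. "For every sufficiently small $\varepsilon>0$" means: there is $\varepsilon_0>0$ (depending on $f,g$) such that the assertion holds for all $0<\varepsilon\le\varepsilon_0$. For holomorphic $h$, $\mathrm{grad}\,h=\left(\overline{\partial h/\partial z_1},\ldots,\overline{\partial h/\partial z_n}\right)$; thus $\mathrm{grad}\log f(p)$ has $j$-th entry $\overline{\frac{1}{f(p)}\frac{\partial f}{\partial z_j}(p)}$. *)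

theory Defs
  imports "HOL-Analysis.Analysis" "HOL-Library.Poly_Mapping"
begin

text \<open>The ring of complex polynomials in variables indexed by the finite type \<open>'n\<close>: a polynomial
  is a finitely supported map from exponent vectors to coefficients.\<close>

type_synonym 'n cpoly = "('n \<Rightarrow>\<^sub>0 nat) \<Rightarrow>\<^sub>0 complex"

definition cpoly_eval :: "('n::finite) cpoly \<Rightarrow> complex ^ 'n \<Rightarrow> complex" where
  "cpoly_eval P z =
     (\<Sum>m\<in>Poly_Mapping.keys P.
        Poly_Mapping.lookup P m * (\<Prod>j\<in>UNIV. (z $ j) ^ Poly_Mapping.lookup m j))"

definition complex_partial :: "(complex ^ 'n::finite \<Rightarrow> complex) \<Rightarrow> 'n \<Rightarrow> complex ^ 'n \<Rightarrow> complex" where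
  "complex_partial h j z = deriv (\<lambda>w. h (\<chi> k. if k = j then w else z $ k)) (z $ j)"

text \<open>The gradient of \<open>log h\<close>, \<open>(grad log h)\<^sub>j = cnj (\<partial>\<^sub>j h / h)\<close>, which does not depend on a branch
  of the logarithm; it is meaningful only where \<open>h z \<noteq> 0\<close>.\<close>

definition grad_log :: "(complex ^ 'n::finite \<Rightarrow> complex) \<Rightarrow> complex ^ 'n \<Rightarrow> complex ^ 'n" where
  "grad_log h z = (\<chi> j. cnj (1 / h z * complex_partial h j z))"

text \<open>Tangent vectors of an embedded submanifold \<open>M\<close> are velocities of \<open>C\<^sup>1\<close> curves in \<open>M\<close>, and the
  differential of a map on \<open>M\<close> sends the velocity of a curve to the velocity of its image. Only
  the values of the map on \<open>M\<close> enter.\<close>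

definition curve_with_velocity ::
  "'a::real_normed_vector set \<Rightarrow> 'a \<Rightarrow> 'a \<Rightarrow> (real \<Rightarrow> 'a) \<Rightarrow> bool" where
  "curve_with_velocity M p v \<gamma> \<longleftrightarrow>
     \<gamma> 0 = p \<and> (\<gamma> has_vector_derivative v) (at 0) \<and>
     (\<exists>\<delta>>0. \<gamma> C1_differentiable_on {-\<delta><..<\<delta>} \<and> \<gamma> ` {-\<delta><..<\<delta>} \<subseteq> M)"

definition tangent_space :: "'a::real_normed_vector set \<Rightarrow> 'a \<Rightarrow> 'a set" where
  "tangent_space M p = {v. \<exists>\<gamma>. curve_with_velocity M p v \<gamma>}"

definition differential ::
  "'a::real_normed_vector set \<Rightarrow> ('a \<Rightarrow> 'b::real_normed_vector) \<Rightarrow> 'a \<Rightarrow> 'a \<Rightarrow> 'b" where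
  "differential M F p v =
     (THE w. \<forall>\<gamma>. curve_with_velocity M p v \<gamma> \<longrightarrow> ((F \<circ> \<gamma>) has_vector_derivative w) (at 0))"

definition differential_rank ::
  "'a::real_normed_vector set \<Rightarrow> ('a \<Rightarrow> 'b::euclidean_space) \<Rightarrow> 'a \<Rightarrow> nat" where
  "differential_rank M F p = dim (differential M F p ` tangent_space M p)"

definition link :: "(complex ^ 'n::finite \<Rightarrow> complex) \<Rightarrow> (complex ^ 'n \<Rightarrow> complex) \<Rightarrow> real \<Rightarrow> (complex ^ 'n) set" where
  "link f g \<epsilon> = {z \<in> sphere 0 \<epsilon>. f z * g z = 0}"

text \<open>The torus is viewed inside \<open>\<complex> \<times> \<complex>\<close>, which does not affect the rank of the differential.\<close>

definition milnor_product_map ::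
  "(complex ^ 'n::finite \<Rightarrow> complex) \<Rightarrow> (complex ^ 'n \<Rightarrow> complex) \<Rightarrow> complex ^ 'n \<Rightarrow> complex \<times> complex" where
  "milnor_product_map f g z =
     (f z / complex_of_real (cmod (f z)), g z / complex_of_real (cmod (g z)))"

definition milnor_singular_point ::
  "(complex ^ 'n::finite \<Rightarrow> complex) \<Rightarrow> (complex ^ 'n \<Rightarrow> complex) \<Rightarrow> real \<Rightarrow> complex ^ 'n \<Rightarrow> bool" where
  "milnor_singular_point f g \<epsilon> p \<longleftrightarrow>
     differential_rank (sphere 0 \<epsilon> - link f g \<epsilon>) (milnor_product_map f g) p < 2"

text \<open>Linear dependence of a family of three vectors. This differs from dependence of the set
  \<open>{x, y, z}\<close>, which does not see a repeated vector.\<close>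

definition real_dependent3 :: "'a::real_vector \<Rightarrow> 'a \<Rightarrow> 'a \<Rightarrow> bool" where
  "real_dependent3 x y z \<longleftrightarrow>
     (\<exists>a b c :: real. (a, b, c) \<noteq> (0, 0, 0) \<and> a *\<^sub>R x + b *\<^sub>R y + c *\<^sub>R z = 0)"

end

theory Submission imports Defs begin

text \<open>Along a curve with velocity \<open>w\<close>, the arguments of \<open>f\<close> and \<open>g\<close> move with speeds \<open>w \<bullet> u\<close> and
  \<open>w \<bullet> v\<close>, where \<open>u = \<i> grad log f\<close>, \<open>v = \<i> grad log g\<close> and \<open>\<bullet>\<close> is the real inner product. So the
  rank at \<open>p\<close> is that of \<open>w \<mapsto> (w \<bullet> u, w \<bullet> v)\<close> on the tangent space \<open>p\<^sup>\<bottom>\<close> of the sphere, and it drops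
  exactly if some nontrivial combination of \<open>u\<close> and \<open>v\<close> is orthogonal to \<open>p\<^sup>\<bottom>\<close>, that is, a multiple
  of \<open>p\<close>.\<close>

section \<open>Complex derivatives of polynomials\<close>

text \<open>Complex linearity of the real derivative is recorded as mere existence of coefficients,
  so that the closure rules chain through a polynomial without tracking them;
  \<open>complex_partial_eq\<close> identifies them afterwards.\<close>

lemma complex_linear_derivative_mult:
  fixes F G :: "complex ^ 'n::finite \<Rightarrow> complex"
  assumes "\<exists>c. (F has_derivative (\<lambda>w. \<Sum>j\<in>UNIV. c j * w $ j)) (at z)"
    and "\<exists>c. (G has_derivative (\<lambda>w. \<Sum>j\<in>UNIV. c j * w $ j)) (at z)"
  shows "\<exists>c. ((\<lambda>x. F x * G x) has_derivative (\<lambda>w. \<Sum>j\<in>UNIV. c j * w $ j)) (at z)"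
proof -
  obtain c d where c: "(F has_derivative (\<lambda>w. \<Sum>j\<in>UNIV. c j * w $ j)) (at z)"
    and d: "(G has_derivative (\<lambda>w. \<Sum>j\<in>UNIV. d j * w $ j)) (at z)"
    using assms by blast
  have "((\<lambda>x. F x * G x) has_derivative (\<lambda>w. \<Sum>j\<in>UNIV. (F z * d j + c j * G z) * w $ j)) (at z)"
    by (rule has_derivative_eq_rhs[OF has_derivative_mult[OF c d]])
      (simp add: fun_eq_iff sum_distrib_left sum_distrib_right distrib_left sum.distrib mult_ac)
  then show ?thesis by (rule exI[of _ "\<lambda>j. F z * d j + c j * G z"])
qed

lemma complex_linear_derivative_sum:
  fixes F :: "'i \<Rightarrow> complex ^ 'n::finite \<Rightarrow> complex"
  assumes "\<And>i. i \<in> I \<Longrightarrow> \<exists>c. (F i has_derivative (\<lambda>w. \<Sum>j\<in>UNIV. c j * w $ j)) (at z)"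
  shows "\<exists>c. ((\<lambda>x. \<Sum>i\<in>I. F i x) has_derivative (\<lambda>w. \<Sum>j\<in>UNIV. c j * w $ j)) (at z)"
proof -
  \<comment> \<open>The hypothesis gives coefficients for each \<open>i\<close> separately; choosing
    them as a function of \<open>i\<close> allows them to be summed.\<close>
  define c where "c i = (SOME c. (F i has_derivative (\<lambda>w. \<Sum>j\<in>UNIV. c j * w $ j)) (at z))" for i
  have c: "(F i has_derivative (\<lambda>w. \<Sum>j\<in>UNIV. c i j * w $ j)) (at z)" if "i \<in> I" for i
    unfolding c_def using assms[OF that] by (rule someI_ex)
  have "((\<lambda>x. \<Sum>i\<in>I. F i x) has_derivative (\<lambda>w. \<Sum>i\<in>I. \<Sum>j\<in>UNIV. c i j * w $ j)) (at z)"
    by (rule has_derivative_sum[OF c])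
  also have "(\<lambda>w. \<Sum>i\<in>I. \<Sum>j\<in>UNIV. c i j * w $ j) = (\<lambda>w. \<Sum>j\<in>UNIV. (\<Sum>i\<in>I. c i j) * w $ j)"
    by (subst sum.swap) (simp add: sum_distrib_right)
  finally have "((\<lambda>x. \<Sum>i\<in>I. F i x) has_derivative (\<lambda>w. \<Sum>j\<in>UNIV. (\<Sum>i\<in>I. c i j) * w $ j)) (at z)" .
  then show ?thesis by (rule exI[of _ "\<lambda>j. \<Sum>i\<in>I. c i j"])
qed

lemma complex_linear_derivative_const:
  "\<exists>c. ((\<lambda>x. a) has_derivative (\<lambda>w. \<Sum>j\<in>UNIV. c j * w $ j)) (at (z :: complex ^ 'n::finite))"
  by (rule exI[of _ "\<lambda>_. 0"]) simp

lemma complex_linear_derivative_nth: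
  "\<exists>c. ((\<lambda>x. x $ i) has_derivative (\<lambda>w. \<Sum>j\<in>UNIV. c j * w $ j)) (at (z :: complex ^ 'n::finite))"
proof -
  have "((\<lambda>x. x $ i) has_derivative (\<lambda>w. \<Sum>j\<in>UNIV. (if j = i then 1 else 0) * w $ j)) (at z)"
    by (rule has_derivative_eq_rhs[OF bounded_linear_imp_has_derivative[OF bounded_linear_vec_nth]])
      (simp add: fun_eq_iff if_distrib[of "\<lambda>a. a * _"] cong: if_cong)
  then show ?thesis by (rule exI[of _ "\<lambda>j. if j = i then 1 else 0"])
qed

lemma complex_linear_derivative_power:
  fixes F :: "complex ^ 'n::finite \<Rightarrow> complex"
  assumes "\<exists>c. (F has_derivative (\<lambda>w. \<Sum>j\<in>UNIV. c j * w $ j)) (at z)"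
  shows "\<exists>c. ((\<lambda>x. F x ^ k) has_derivative (\<lambda>w. \<Sum>j\<in>UNIV. c j * w $ j)) (at z)"
proof (induction k)
  case 0
  then show ?case using complex_linear_derivative_const[of 1 z] by simp
next
  case (Suc k)
  from complex_linear_derivative_mult[OF assms Suc] show ?case by simp
qed

lemma complex_linear_derivative_prod:
  fixes F :: "'i \<Rightarrow> complex ^ 'n::finite \<Rightarrow> complex"
  assumes "finite I"
    and "\<And>i. i \<in> I \<Longrightarrow> \<exists>c. (F i has_derivative (\<lambda>w. \<Sum>j\<in>UNIV. c j * w $ j)) (at z)"
  shows "\<exists>c. ((\<lambda>x. \<Prod>i\<in>I. F i x) has_derivative (\<lambda>w. \<Sum>j\<in>UNIV. c j * w $ j)) (at z)"
  using assms
proof (induction I)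
  case empty
  then show ?case using complex_linear_derivative_const[of 1 z] by simp
next
  case (insert i I)
  then have "\<exists>c. ((\<lambda>x. F i x * (\<Prod>i\<in>I. F i x)) has_derivative (\<lambda>w. \<Sum>j\<in>UNIV. c j * w $ j)) (at z)"
    by (intro complex_linear_derivative_mult) auto
  with insert show ?case by simp
qed

lemma cpoly_eval_complex_linear_derivative:
  "\<exists>c. (cpoly_eval P has_derivative (\<lambda>w. \<Sum>j\<in>UNIV. c j * w $ j)) (at z)"
  unfolding cpoly_eval_def
  by (intro complex_linear_derivative_sum complex_linear_derivative_mult
      complex_linear_derivative_const complex_linear_derivative_prod
      complex_linear_derivative_power complex_linear_derivative_nth finite)

text \<open>Restricting \<open>h\<close> to the complex line through \<open>z\<close> in direction
  \<open>j\<close> turns the derivative into multiplication by \<open>c j\<close>, by the chain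
  rule.\<close>

lemma complex_partial_eq:
  fixes h :: "complex ^ 'n::finite \<Rightarrow> complex"
  assumes "(h has_derivative (\<lambda>w. \<Sum>j\<in>UNIV. c j * w $ j)) (at z)"
  shows "complex_partial h j z = c j"
proof -
  let ?L = "\<lambda>w. \<chi> k. if k = j then w else z $ k"
  have "((\<lambda>w. ?L w $ k) has_derivative (\<lambda>w. axis j w $ k)) (at (z $ j))" for k
    by (cases "k = j") (simp_all add: axis_def)
  \<comment> \<open>Differentiability is tested against the real basis, whose vectors are
    \<open>axis k b\<close> with \<open>b\<close> equal to 1 or \<i>, so the coordinatewise
    derivatives suffice.\<close>
  then have "(?L has_derivative axis j) (at (z $ j))"
    by (subst has_derivative_componentwise_within)
      (auto simp: Basis_vec_def inner_axis intro!: derivative_eq_intros)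
  moreover have "?L (z $ j) = z"
    by (simp add: vec_eq_iff)
  ultimately have "((\<lambda>w. h (?L w)) has_derivative (\<lambda>w. \<Sum>k\<in>UNIV. c k * axis j w $ k)) (at (z $ j))"
    using has_derivative_compose[of ?L "axis j" "z $ j" UNIV h] assms by simp
  moreover have "(\<lambda>w. \<Sum>k\<in>UNIV. c k * axis j w $ k) = (*) (c j)"
    by (simp add: axis_def fun_eq_iff if_distrib[of "\<lambda>a. _ * a"] cong: if_cong)
  ultimately show ?thesis
    unfolding complex_partial_def by (intro DERIV_imp_deriv) (simp add: has_field_derivative_def)
qed

lemma cpoly_eval_has_derivative:
  "(cpoly_eval P has_derivative (\<lambda>w. \<Sum>j\<in>UNIV. complex_partial (cpoly_eval P) j z * w $ j)) (at z)"
proof -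
  obtain c where "(cpoly_eval P has_derivative (\<lambda>w. \<Sum>j\<in>UNIV. c j * w $ j)) (at z)"
    using cpoly_eval_complex_linear_derivative by blast
  with complex_partial_eq[OF this] show ?thesis by simp
qed

section \<open>The derivative of the argument\<close>

text \<open>Relative to \<open>z\<close>, a velocity \<open>w\<close> has radial part
  \<open>Re (w / z)\<close> and angular part \<open>Im (w / z)\<close>. Normalising removes the
  former, and the latter turns the unit vector along its tangent.\<close>

lemma has_derivative_complex_direction:
  assumes "z \<noteq> (0::complex)"
  shows "((\<lambda>x. x / complex_of_real (cmod x)) has_derivative
           (\<lambda>w. \<i> * (z / complex_of_real (cmod z)) * complex_of_real (Im (w / z)))) (at z)"
proof -
  have "((\<lambda>x. x / complex_of_real (cmod x)) has_derivative
      (\<lambda>w. w / cmod z - z * complex_of_real (w \<bullet> sgn z) / (cmod z)\<^sup>2)) (at z)"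
    using assms
    by (auto intro!: derivative_eq_intros has_derivative_norm simp: fun_eq_iff field_simps power2_eq_square)
  moreover have "w / cmod z - z * complex_of_real (w \<bullet> sgn z) / (cmod z)\<^sup>2
      = \<i> * (z / complex_of_real (cmod z)) * complex_of_real (Im (w / z))" for w :: complex
  proof -
    define q where "q = w / z"
    have w: "w = z * q" using assms by (simp add: q_def)
    have "w \<bullet> sgn z = cmod z * Re q"
    proof -
      have "w \<bullet> z = (cmod z)\<^sup>2 * Re q"
        unfolding w cmod_power2 by (simp add: inner_complex_def power2_eq_square algebra_simps)
      then show ?thesis using assms by (simp add: sgn_div_norm power2_eq_square)
    qed
    moreover have "\<i> * complex_of_real (Im q) = q - complex_of_real (Re q)"
      by (simp add: complex_eq_iff)
    moreover have "w / cmod z - z * complex_of_real (cmod z * Re q) / (cmod z)\<^sup>2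
        = z / cmod z * (q - complex_of_real (Re q))"
      using assms unfolding w by (simp add: field_simps power2_eq_square)
    ultimately show ?thesis
      unfolding q_def[symmetric] by (simp add: mult_ac)
  qed
  ultimately show ?thesis by (simp only:)
qed

text \<open>By the chain rule the angular speed is the imaginary part of the logarithmic derivative.
  The identity \<open>Im (q * b) = b \<bullet> (\<i> * cnj q)\<close> in each coordinate makes it a
  real inner product.\<close>

lemma has_derivative_direction_grad_log:
  fixes h :: "complex ^ 'n::finite \<Rightarrow> complex"
  assumes "(h has_derivative (\<lambda>w. \<Sum>j\<in>UNIV. complex_partial h j z * w $ j)) (at z)" and "h z \<noteq> 0"
  shows "((\<lambda>x. h x / complex_of_real (cmod (h x))) has_derivative
    (\<lambda>w. \<i> * (h z / complex_of_real (cmod (h z))) * complex_of_real (w \<bullet> (\<i> *s grad_log h z)))) (at z)"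
proof -
  have "Im ((\<Sum>j\<in>UNIV. complex_partial h j z * w $ j) / h z) = w \<bullet> (\<i> *s grad_log h z)" for w
  proof -
    have "Im (a * b / c) = b \<bullet> (\<i> * cnj (1 / c * a))" for a b c :: complex
    proof -
      have "Im (q * b) = b \<bullet> (\<i> * cnj q)" for q
        by (simp add: inner_complex_def)
      from this[of "1 / c * a"] show ?thesis by simp
    qed
    then show ?thesis
      by (simp only: inner_vec_def grad_log_def vector_smult_component vec_lambda_beta
          sum_divide_distrib Im_sum)
  qed
  then show ?thesis
    using has_derivative_compose[OF assms(1) has_derivative_complex_direction[OF assms(2)]] by simp
qed

section \<open>Tangent vectors of a relatively open part of a sphere\<close>

text \<open>Differentiate the constant function \<open>\<gamma> t \<bullet> \<gamma> t\<close> at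
  0.\<close>

lemma curve_in_sphere_orthogonal:
  fixes p :: "'a::real_inner"
  assumes "curve_with_velocity M p w \<gamma>" and "M \<subseteq> sphere 0 r"
  shows "p \<bullet> w = 0"
proof -
  obtain \<delta> where "\<delta> > 0" and im: "\<gamma> ` {-\<delta><..<\<delta>} \<subseteq> M" and "\<gamma> 0 = p"
    and d: "(\<gamma> has_derivative (\<lambda>t. t *\<^sub>R w)) (at 0)"
    using assms(1) unfolding curve_with_velocity_def has_vector_derivative_def by blast
  have "((\<lambda>t. \<gamma> t \<bullet> \<gamma> t) has_derivative (\<lambda>t. \<gamma> 0 \<bullet> (t *\<^sub>R w) + (t *\<^sub>R w) \<bullet> \<gamma> 0)) (at 0)"
    by (rule has_derivative_inner[OF d d])
  moreover have "((\<lambda>t. \<gamma> t \<bullet> \<gamma> t) has_derivative (\<lambda>t. 0)) (at 0)"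
  proof (rule has_derivative_transform_within_open[of "\<lambda>_. r\<^sup>2"])
    show "open {-\<delta><..<\<delta>}" "0 \<in> {-\<delta><..<\<delta>}" using \<open>\<delta> > 0\<close> by auto
    show "r\<^sup>2 = \<gamma> t \<bullet> \<gamma> t" if "t \<in> {-\<delta><..<\<delta>}" for t
      using that im assms(2) by (force simp: dot_square_norm)
  qed simp
  ultimately have "(\<lambda>t. \<gamma> 0 \<bullet> (t *\<^sub>R w) + (t *\<^sub>R w) \<bullet> \<gamma> 0) = (\<lambda>t. 0)"
    by (rule has_derivative_unique)
  from fun_cong[OF this, of 1] show ?thesis
    using \<open>\<gamma> 0 = p\<close> by (simp add: inner_commute)
qed

lemma great_circle_curve:
  fixes p :: "'a::euclidean_space"
  assumes "p \<in> M" "openin (top_of_set (sphere 0 r)) M" "r > 0" "p \<bullet> w = 0"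
  shows "\<exists>\<gamma>. curve_with_velocity M p w \<gamma>"
proof -
  obtain U where "open U" and M: "M = sphere 0 r \<inter> U"
    using assms(2) by (auto simp: openin_open)
  have np: "norm p = r" using assms(1) M by auto
  \<comment> \<open>The curve is a great circle: \<open>k\<close> is its angular speed and
    \<open>u\<close> is \<open>w\<close> rescaled to length \<open>r\<close>. For
    \<open>w = 0\<close>, division by zero gives \<open>u = 0\<close>, and the curve rests at
    \<open>p\<close>.\<close>
  define k where "k = norm w / r"
  define u where "u = (1 / k) *\<^sub>R w"
  define \<gamma> where "\<gamma> t = cos (k * t) *\<^sub>R p + sin (k * t) *\<^sub>R u" for t
  have ku: "k *\<^sub>R u = w" using assms(3) by (auto simp: u_def k_def)
  have pu: "p \<bullet> u = 0" using assms(4) by (simp add: u_def)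
  have uu: "k = 0 \<or> u \<bullet> u = r\<^sup>2"
    using assms(3) by (auto simp: u_def k_def dot_square_norm power2_eq_square)
  have deriv: "(\<gamma> has_vector_derivative - sin (k * t) *\<^sub>R k *\<^sub>R p + cos (k * t) *\<^sub>R w) (at t)" for t
    unfolding \<gamma>_def ku[symmetric]
    by (auto intro!: derivative_eq_intros simp: algebra_simps)
  have sphere: "\<gamma> t \<in> sphere 0 r" for t
  proof -
    have "\<gamma> t \<bullet> \<gamma> t = (cos (k * t))\<^sup>2 * r\<^sup>2 + (sin (k * t))\<^sup>2 * (u \<bullet> u)"
      unfolding \<gamma>_def np[symmetric] dot_square_norm[symmetric]
      using pu by (simp add: inner_add inner_commute power2_eq_square)
    also have "\<dots> = r\<^sup>2"
      using uu by (auto simp flip: distrib_right)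
    finally show ?thesis
      using assms(3) by (simp add: norm_eq_sqrt_inner)
  qed
  have "continuous_on UNIV \<gamma>"
    unfolding \<gamma>_def by (intro continuous_intros)
  then have "open (\<gamma> -` U)"
    using open_vimage[OF \<open>open U\<close>] by simp
  moreover have "\<gamma> 0 = p" by (simp add: \<gamma>_def)
  \<comment> \<open>Relative openness of \<open>M\<close> keeps the great circle inside
    \<open>M\<close> for a short time.\<close>
  ultimately obtain \<delta> where "\<delta> > 0" and \<delta>: "ball 0 \<delta> \<subseteq> \<gamma> -` U"
    using assms(1) M by (metis IntD2 open_contains_ball vimageI)
  have "\<gamma> C1_differentiable_on {-\<delta><..<\<delta>}"
    unfolding C1_differentiable_on_def using deriv
    by (intro exI[of _ "\<lambda>t. - sin (k * t) *\<^sub>R k *\<^sub>R p + cos (k * t) *\<^sub>R w"])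
      (auto intro!: continuous_intros)
  moreover have "\<gamma> ` {-\<delta><..<\<delta>} \<subseteq> M"
    using \<delta> sphere unfolding M by (force simp: dist_real_def)
  moreover have "(\<gamma> has_vector_derivative w) (at 0)"
    using deriv[of 0] by simp
  ultimately show ?thesis
    using \<open>\<gamma> 0 = p\<close> \<open>\<delta> > 0\<close> unfolding curve_with_velocity_def by blast
qed

lemma tangent_space_sphere_open:
  fixes p :: "'a::euclidean_space"
  assumes "p \<in> M" "openin (top_of_set (sphere 0 r)) M" "r > 0"
  shows "tangent_space M p = {w. p \<bullet> w = 0}"
  using great_circle_curve[OF assms] curve_in_sphere_orthogonal openin_imp_subset[OF assms(2)]
  unfolding tangent_space_def by blast

text \<open>The chain rule gives the value \<open>D w\<close> along every curve with velocity
  \<open>w\<close>. Since \<open>w\<close> is tangent, at least one such curve exists, which makes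
  the value described by \<open>THE\<close> unique.\<close>

lemma differential_eq:
  assumes "(F has_derivative D) (at p)" and "w \<in> tangent_space M p"
  shows "differential M F p w = D w"
proof -
  have *: "((F \<circ> \<gamma>) has_vector_derivative D w) (at 0)" if "curve_with_velocity M p w \<gamma>" for \<gamma>
  proof -
    have "\<gamma> 0 = p" and g: "(\<gamma> has_derivative (\<lambda>t. t *\<^sub>R w)) (at 0)"
      using that by (auto simp: curve_with_velocity_def has_vector_derivative_def)
    with has_derivative_compose[OF g] assms(1)
    have "((\<lambda>t. F (\<gamma> t)) has_derivative (\<lambda>t. D (t *\<^sub>R w))) (at 0)" by blast
    then show ?thesis
      using linear_scale[OF has_derivative_linear[OF assms(1)]]
      by (simp add: has_vector_derivative_def o_def)
  qed
  obtain \<gamma>0 where "curve_with_velocity M p w \<gamma>0"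
    using assms(2) by (auto simp: tangent_space_def)
  then show ?thesis
    unfolding differential_def
    by (intro the_equality) (use * vector_derivative_unique_at in blast)+
qed

section \<open>The rank of two functionals on a hyperplane\<close>

lemma dim_inner_pair_image:
  fixes p u v :: "'a::euclidean_space"
  assumes "p \<noteq> 0"
  shows "dim ((\<lambda>w. (w \<bullet> u, w \<bullet> v)) ` {w. p \<bullet> w = 0}) < 2 \<longleftrightarrow> real_dependent3 p u v"
    (is "dim ?S < 2 \<longleftrightarrow> _")
proof
  assume "dim ?S < 2"
  \<comment> \<open>A proper subspace of the plane has a nonzero normal vector; its entries become
    the coefficients of \<open>u\<close> and \<open>v\<close>.\<close>
  then obtain x where "x \<noteq> 0" and x: "\<And>y. y \<in> span ?S \<Longrightarrow> orthogonal x y"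
    using orthogonal_to_subspace_exists[of ?S] by auto
  obtain b c where bc: "x = (b, c)" by (cases x)
  define q where "q = b *\<^sub>R u + c *\<^sub>R v"
  have q: "w \<bullet> q = 0" if "p \<bullet> w = 0" for w
    using x[of "(w \<bullet> u, w \<bullet> v)"] that
    by (auto simp: bc q_def orthogonal_def inner_add intro!: span_base)
  \<comment> \<open>With this \<open>a\<close>, \<open>q - a *\<^sub>R p\<close> is the part of
    \<open>q\<close> orthogonal to \<open>p\<close>. It is then orthogonal to \<open>q\<close> as
    well, hence to itself.\<close>
  define a where "a = (p \<bullet> q) / (p \<bullet> p)"
  have "p \<bullet> (q - a *\<^sub>R p) = 0"
    using assms by (simp add: a_def inner_diff)
  then have "(q - a *\<^sub>R p) \<bullet> (q - a *\<^sub>R p) = 0"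
    using q[of "q - a *\<^sub>R p"] by (simp add: inner_diff(2)[of "q - a *\<^sub>R p"] inner_commute[of _ p])
  then have "q = a *\<^sub>R p"
    by simp
  then have "(-a) *\<^sub>R p + b *\<^sub>R u + c *\<^sub>R v = 0"
    by (simp add: q_def algebra_simps)
  moreover have "(-a, b, c) \<noteq> (0, 0, 0)"
    using \<open>x \<noteq> 0\<close> bc by (auto simp: zero_prod_def)
  ultimately show "real_dependent3 p u v"
    unfolding real_dependent3_def by blast
next
  assume "real_dependent3 p u v"
  then obtain a b c where ne: "(a, b, c) \<noteq> (0, 0, 0)" and eq: "a *\<^sub>R p + b *\<^sub>R u + c *\<^sub>R v = 0"
    unfolding real_dependent3_def by blast
  \<comment> \<open>If \<open>b\<close> and \<open>c\<close> vanished,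
    \<open>a *\<^sub>R p = 0\<close> with \<open>p \<noteq> 0\<close> would force
    \<open>a = 0\<close> too.\<close>
  have bc: "(b, c) \<noteq> 0"
    using ne eq assms by (auto simp: zero_prod_def)
  have "(b, c) \<bullet> (w \<bullet> u, w \<bullet> v) = 0" if "p \<bullet> w = 0" for w
    using arg_cong[OF eq, of "\<lambda>x. w \<bullet> x"] that by (simp add: inner_add inner_commute)
  then have "?S \<subseteq> {y. (b, c) \<bullet> y = 0}" by auto
  then have "dim ?S \<le> dim {y. (b, c) \<bullet> y = 0}" by (rule dim_subset)
  also have "\<dots> = 1" using dim_hyperplane[OF bc] by simp
  finally show "dim ?S < 2" by simp
qed

section \<open>Singular points of the product map\<close>

lemma milnor_singular_point_iff:
  fixes f g :: "complex ^ 'n::finite \<Rightarrow> complex"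
  assumes df: "\<And>z. (f has_derivative (\<lambda>w. \<Sum>j\<in>UNIV. complex_partial f j z * w $ j)) (at z)"
    and dg: "\<And>z. (g has_derivative (\<lambda>w. \<Sum>j\<in>UNIV. complex_partial g j z * w $ j)) (at z)"
    and "\<epsilon> > 0" and p: "p \<in> sphere 0 \<epsilon> - link f g \<epsilon>"
  shows "milnor_singular_point f g \<epsilon> p \<longleftrightarrow> real_dependent3 p (\<i> *s grad_log f p) (\<i> *s grad_log g p)"
proof -
  let ?M = "sphere 0 \<epsilon> - link f g \<epsilon>"
  let ?T = "\<lambda>w. (w \<bullet> (\<i> *s grad_log f p), w \<bullet> (\<i> *s grad_log g p))"
  \<comment> \<open>\<open>s\<close> and \<open>t\<close> are the unit tangents of the two circles
    at the image of \<open>p\<close>, so \<open>L\<close> identifies the real plane with the tangent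
    plane of the torus.\<close>
  define s where "s = \<i> * (f p / complex_of_real (cmod (f p)))"
  define t where "t = \<i> * (g p / complex_of_real (cmod (g p)))"
  define L where "L x = (s * complex_of_real (fst x), t * complex_of_real (snd x))" for x
  have nz: "f p \<noteq> 0" "g p \<noteq> 0" "p \<noteq> 0"
    using p \<open>\<epsilon> > 0\<close> by (auto simp: link_def)
  \<comment> \<open>Continuity makes the complement of the link relatively open in the sphere, so
    its tangent space is the whole hyperplane orthogonal to \<open>p\<close>.\<close>
  have "continuous_on UNIV (\<lambda>z. f z * g z)"
    using df dg by (intro continuous_on_mult has_derivative_continuous_on) (auto intro: has_derivative_at_withinI)
  then have "open {z. f z * g z \<noteq> 0}"
    by (intro open_Collect_neq) auto
  moreover have "?M = sphere 0 \<epsilon> \<inter> {z. f z * g z \<noteq> 0}"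
    by (auto simp: link_def)
  ultimately have "openin (top_of_set (sphere 0 \<epsilon>)) ?M"
    by (auto simp: openin_open)
  then have ts: "tangent_space ?M p = {w. p \<bullet> w = 0}"
    by (rule tangent_space_sphere_open[OF p _ \<open>\<epsilon> > 0\<close>])
  have "(milnor_product_map f g has_derivative L \<circ> ?T) (at p)"
    using has_derivative_Pair[OF has_derivative_direction_grad_log[OF df nz(1)]
        has_derivative_direction_grad_log[OF dg nz(2)]]
    by (simp add: milnor_product_map_def[abs_def] L_def s_def t_def o_def)
  then have "differential ?M (milnor_product_map f g) p ` tangent_space ?M p = L ` ?T ` {w. p \<bullet> w = 0}"
    using differential_eq[of "milnor_product_map f g" "L \<circ> ?T" p _ ?M] ts by (force simp: image_image)
  moreover have "linear L"
    by (rule linearI) (auto simp: L_def algebra_simps scaleR_conv_of_real)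
  \<comment> \<open>An injective linear map preserves dimension, so only the rank of
    \<open>?T\<close> on the hyperplane remains.\<close>
  moreover have "inj L"
    using nz by (auto simp: inj_def L_def s_def t_def prod_eq_iff)
  ultimately have "differential_rank ?M (milnor_product_map f g) p = dim (?T ` {w. p \<bullet> w = 0})"
    unfolding differential_rank_def by (simp add: dim_image_eq inj_on_subset[OF _ subset_UNIV])
  then show ?thesis
    unfolding milnor_singular_point_def using dim_inner_pair_image[OF nz(3)] by simp
qed

theorem lemma3p1:
  fixes f g :: "('n::finite) cpoly"
  assumes "CARD('n) \<ge> 2"
    and "cpoly_eval f 0 = 0" and "cpoly_eval g 0 = 0"
  shows "\<exists>\<epsilon>\<^sub>0>0. \<forall>\<epsilon>. 0 < \<epsilon> \<and> \<epsilon> \<le> \<epsilon>\<^sub>0 \<longrightarrow>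
    (\<forall>p \<in> sphere 0 \<epsilon> - link (cpoly_eval f) (cpoly_eval g) \<epsilon>.
       milnor_singular_point (cpoly_eval f) (cpoly_eval g) \<epsilon> p \<longleftrightarrow>
       real_dependent3 p (\<i> *s grad_log (cpoly_eval f) p) (\<i> *s grad_log (cpoly_eval g) p))"
  \<comment> \<open>\<open>milnor_singular_point_iff\<close> applies at every positive radius, so
    any positive number can serve as \<open>\<epsilon>\<^sub>0\<close>; 1 is chosen.\<close>
  by (intro exI[of _ 1] conjI allI impI ballI
      milnor_singular_point_iff[OF cpoly_eval_has_derivative cpoly_eval_has_derivative]) auto

end
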